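(* For every diagram $(G,l)$, $G=(V,E)$, over a monoid $M$, the Core Algorithm run on $(G,l)$ performs no more than $$|E'|\cdot\min(|V|,|E'|+1)\le\min(|V|^2,|E|)\cdot\min(|V|,|E|+1)$$ multiplication operations in $M$, where $E'$ denotes the set of edges of $G$ remaining after removing loops and multiple edges.
   Context: An oriented graph $G=(V,E)$ is a pair of finite nonempty sets (vertices and edges) with functions $t,o:E\to V$ giving the tail (end point) $t(e)$ and origin (starting point) $o(e)$ of each edge; loops and multiple edges are allowed. A diagram $(G,l)$ over a monoid $M$ is an oriented graph with a labeling $l:E\to M$. The set $E'\subseteq E$ is obtained from $E$ by deleting all loops and keeping exactly one edge from each class of edges with the same origin and the same tail. Core Algorithm (input: a diagram $(G,l)$ over $M$; "exit" terminates the whole algorithm): 1. RemoveLoops: for each vertex $v$ and each edge $e$ with $o(e)=v$: if $t(e)=v$, then exit with False if $l(e)\ne\mathbf 1_M$, and otherwise remove $e$ from $G$. 2. RemoveMultipleEdges: for each vertex $v$: create an empty array $T$ indexed by $V$; for each remaining edge $e$ with $o(e)=v$: if $T[t(e)]$ is empty, set $T[t(e)]=l(e)$; otherwise exit with False if $l(e)\neq T[t(e)]$, and else remove $e$ from $G$. 3. For each vertex $v\in V$: mark all vertices as not visited, set $m(w)=\mathbf 1_M$ for all $w\in V$, and run DFS$(G,v)$. 4. Exit with True. DFS$(G,v)$: mark $v$ as visited; for each remaining edge $e$ with $o(e)=v$, let $u=t(e)$; if $u$ is not visited, call ProceedNewVertex$(v,e,u)$ and then DFS$(G,u)$; otherwise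 call ProceedOldVertex$(v,e,u)$. ProceedNewVertex$(v,e,u)$: set $m(u)=m(v)l(e)$ (one multiplication). ProceedOldVertex$(v,e,u)$: if $m(u)\ne m(v)l(e)$, exit with False (one multiplication and one equality check). *)

theory Defs
  imports "Graph_Theory.Digraph" "HOL-Algebra.Group"
begin

text \<open>
  A diagram over a monoid. Beware of the opposite terminology: the origin of an edge \<open>e\<close> in the
  source is \<open>tail G e\<close> here, and its end point (called ``tail'' in the source) is \<open>head G e\<close>.
  \<open>fin_digraph\<close> allows loops and multiple edges.
\<close>

locale diagram = fin_digraph G + monoid M
  for G :: "('v, 'e) pre_digraph" and M :: "('m, 'x) monoid_scheme" and l :: "'e \<Rightarrow> 'm" +
  assumes verts_nonempty: "verts G \<noteq> {}"
    and arcs_nonempty: "arcs G \<noteq> {}"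
    and label_closed: "e \<in> arcs G \<Longrightarrow> l e \<in> carrier M"

text \<open>
  The sets \<open>E'\<close>: the choice of the representative of each class of parallel edges is left open, so
  this is a predicate.
\<close>

definition reduced_edges :: "('v, 'e) pre_digraph \<Rightarrow> 'e set \<Rightarrow> bool" where
  "reduced_edges G E' \<longleftrightarrow>
     E' \<subseteq> {e \<in> arcs G. head G e \<noteq> tail G e} \<and>
     (\<forall>e \<in> arcs G. head G e \<noteq> tail G e \<longrightarrow>
        (\<exists>!e'. e' \<in> E' \<and> tail G e' = tail G e \<and> head G e' = head G e))"

text \<open>
  The algorithm is given by a big-step semantics: a command relates a state to the possible outcomes
  of its execution. It is nondeterministic only because the order in which a loop
  runs through a set is left open; each execution of a loop may use an order of its own.
  An outcome \<open>Exit b s\<close> terminates the whole algorithm with answer \<open>b\<close>. The field \<open>mults\<close>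
  counts the multiplications performed in the monoid so far; \<open>tab\<close> is the array \<open>T\<close> and
  \<open>mval\<close> is the function \<open>m\<close>.
\<close>

record ('v, 'e, 'm) state =
  remaining :: "'e set"
  tab :: "'v \<Rightarrow> 'm option"
  visited :: "'v set"
  mval :: "'v \<Rightarrow> 'm"
  mults :: nat

datatype 's outcome = Continue 's | Exit bool 's

type_synonym 's command = "'s \<Rightarrow> 's outcome \<Rightarrow> bool"

definition seq :: "'s command \<Rightarrow> 's command \<Rightarrow> 's command" (infixr \<open>andthen\<close> 60) where
  "(c andthen d) s r \<longleftrightarrow>
     (\<exists>s'. c s (Continue s') \<and> d s' r) \<or> (\<exists>b s'. c s (Exit b s') \<and> r = Exit b s')"

inductive iterate :: "('a \<Rightarrow> 's command) \<Rightarrow> 'a list \<Rightarrow> 's command"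
  for body :: "'a \<Rightarrow> 's command"
where
  empty: "iterate body [] s (Continue s)"
| step: "body x s (Continue s') \<Longrightarrow> iterate body xs s' r \<Longrightarrow> iterate body (x # xs) s r"
| exit: "body x s (Exit b s') \<Longrightarrow> iterate body (x # xs) s (Exit b s')"

definition for_each :: "'a set \<Rightarrow> ('a \<Rightarrow> 's command) \<Rightarrow> 's command" where
  "for_each A body s r \<longleftrightarrow> (\<exists>xs. distinct xs \<and> set xs = A \<and> iterate body xs s r)"

lemma iterate_mono:
  assumes "\<And>x s r. body x s r \<longrightarrow> body' x s r"
  shows "iterate body xs s r \<longrightarrow> iterate body' xs s r"
proof
  assume "iterate body xs s r"
  then show "iterate body' xs s r"
  proof induction
    case (empty s)
    show ?case by (rule iterate.empty)
  next
    case (step x s s' xs r)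
    from assms step.hyps(1) have "body' x s (Continue s')" by (rule mp)
    then show ?case using step.IH by (rule iterate.step)
  next
    case (exit x s b s' xs)
    from assms exit have "body' x s (Exit b s')" by (rule mp)
    then show ?case by (rule iterate.exit)
  qed
qed

lemma for_each_mono [mono]:
  assumes "\<And>x s r. body x s r \<longrightarrow> body' x s r"
  shows "for_each A body s r \<longrightarrow> for_each A body' s r"
proof -
  have "iterate body xs s r \<longrightarrow> iterate body' xs s r" for xs
    by (rule iterate_mono) (rule assms)
  then show ?thesis unfolding for_each_def by blast
qed

definition outgoing :: "('v, 'e) pre_digraph \<Rightarrow> ('v, 'e, 'm) state \<Rightarrow> 'v \<Rightarrow> 'e set" where
  "outgoing G s v = {e \<in> remaining s. tail G e = v}"

definition remove_loops ::
    "('v, 'e) pre_digraph \<Rightarrow> ('m, 'x) monoid_scheme \<Rightarrow> ('e \<Rightarrow> 'm) \<Rightarrow> ('v, 'e, 'm) state command" where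
  "remove_loops G M l =
     for_each (verts G) (\<lambda>v s. for_each (outgoing G s v) (\<lambda>e s r. r =
       (if head G e = v then
          if l e \<noteq> \<one>\<^bsub>M\<^esub> then Exit False s
          else Continue (s\<lparr>remaining := remaining s - {e}\<rparr>)
        else Continue s)) s)"

definition remove_multiple_edges ::
    "('v, 'e) pre_digraph \<Rightarrow> ('e \<Rightarrow> 'm) \<Rightarrow> ('v, 'e, 'm) state command" where
  "remove_multiple_edges G l =
     for_each (verts G) (\<lambda>v s. for_each (outgoing G s v) (\<lambda>e s r. r =
       (case tab s (head G e) of
          None \<Rightarrow> Continue (s\<lparr>tab := (tab s)(head G e := Some (l e))\<rparr>)
        | Some a \<Rightarrow>
            if l e \<noteq> a then Exit False s
            else Continue (s\<lparr>remaining := remaining s - {e}\<rparr>))) (s\<lparr>tab := \<lambda>_. None\<rparr>))"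

definition proceed_new_vertex ::
    "('m, 'x) monoid_scheme \<Rightarrow> ('e \<Rightarrow> 'm) \<Rightarrow> 'v \<Rightarrow> 'e \<Rightarrow> 'v \<Rightarrow>
     ('v, 'e, 'm) state \<Rightarrow> ('v, 'e, 'm) state" where
  "proceed_new_vertex M l v e u s =
     s\<lparr>mval := (mval s)(u := mval s v \<otimes>\<^bsub>M\<^esub> l e), mults := mults s + 1\<rparr>"

definition proceed_old_vertex ::
    "('m, 'x) monoid_scheme \<Rightarrow> ('e \<Rightarrow> 'm) \<Rightarrow> 'v \<Rightarrow> 'e \<Rightarrow> 'v \<Rightarrow>
     ('v, 'e, 'm) state \<Rightarrow> ('v, 'e, 'm) state outcome" where
  "proceed_old_vertex M l v e u s =
     (let s' = s\<lparr>mults := mults s + 1\<rparr>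
      in if mval s u \<noteq> mval s v \<otimes>\<^bsub>M\<^esub> l e then Exit False s' else Continue s')"

inductive dfs ::
    "('v, 'e) pre_digraph \<Rightarrow> ('m, 'x) monoid_scheme \<Rightarrow> ('e \<Rightarrow> 'm) \<Rightarrow> 'v \<Rightarrow> ('v, 'e, 'm) state command"
  for G :: "('v, 'e) pre_digraph" and M :: "('m, 'x) monoid_scheme" and l :: "'e \<Rightarrow> 'm"
where
  dfs: "for_each (outgoing G s v) (\<lambda>e s r.
          if head G e \<notin> visited s
          then dfs G M l (head G e) (proceed_new_vertex M l v e (head G e) s) r
          else r = proceed_old_vertex M l v e (head G e) s) (s\<lparr>visited := insert v (visited s)\<rparr>) r
        \<Longrightarrow> dfs G M l v s r"

definition search_all ::
    "('v, 'e) pre_digraph \<Rightarrow> ('m, 'x) monoid_scheme \<Rightarrow> ('e \<Rightarrow> 'm) \<Rightarrow> ('v, 'e, 'm) state command" where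
  "search_all G M l =
     for_each (verts G) (\<lambda>v s. dfs G M l v (s\<lparr>visited := {}, mval := \<lambda>_. \<one>\<^bsub>M\<^esub>\<rparr>))"

definition initial_state ::
    "('v, 'e) pre_digraph \<Rightarrow> ('m, 'x) monoid_scheme \<Rightarrow> ('v, 'e, 'm) state" where
  "initial_state G M =
     \<lparr>remaining = arcs G, tab = \<lambda>_. None, visited = {}, mval = \<lambda>_. \<one>\<^bsub>M\<^esub>, mults = 0\<rparr>"

text \<open>
  \<open>core_algorithm G M l b k\<close>: some run of the Core Algorithm on the diagram \<open>(G, l)\<close> over \<open>M\<close>
  ends with answer \<open>b\<close> after exactly \<open>k\<close> multiplications in \<open>M\<close>.
\<close>

definition core_algorithm ::
    "('v, 'e) pre_digraph \<Rightarrow> ('m, 'x) monoid_scheme \<Rightarrow> ('e \<Rightarrow> 'm) \<Rightarrow> bool \<Rightarrow> nat \<Rightarrow> bool" where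
  "core_algorithm G M l b k \<longleftrightarrow>
     (\<exists>s. (remove_loops G M l andthen remove_multiple_edges G l andthen search_all G M l andthen
            (\<lambda>s r. r = Exit True s)) (initial_state G M) (Exit b s) \<and> mults s = k)"

text \<open>
  Statements about all runs and all sets \<open>E'\<close> are not vacuous: terminating runs and sets \<open>E'\<close> exist.
\<close>

lemma iterate_total:
  assumes "\<And>x s. x \<in> set xs \<Longrightarrow> I s \<Longrightarrow> \<exists>r. body x s r \<and> (\<forall>s'. r = Continue s' \<longrightarrow> I s')"
    and "I s"
  shows "\<exists>r. iterate body xs s r \<and> (\<forall>s'. r = Continue s' \<longrightarrow> I s')"
  using assms
proof (induction xs arbitrary: s)
  case Nil
  then show ?case by (auto intro: iterate.empty)
next
  case (Cons x xs)
  obtain r where r: "body x s r" "\<forall>s'. r = Continue s' \<longrightarrow> I s'"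
    using Cons.prems(1)[of x s] Cons.prems(2) by auto
  show ?case
  proof (cases r)
    case (Continue s')
    with r have "I s'" by simp
    with Cons.prems(1) obtain r' where r': "iterate body xs s' r'" "\<forall>s'. r' = Continue s' \<longrightarrow> I s'"
      using Cons.IH[of s'] by auto
    have "iterate body (x # xs) s r'"
      using r(1) r'(1) unfolding Continue by (rule iterate.step)
    with r'(2) show ?thesis by metis
  next
    case (Exit b s')
    have "iterate body (x # xs) s r" using r(1) unfolding Exit by (rule iterate.exit)
    with r(2) show ?thesis by metis
  qed
qed

lemma for_each_total:
  assumes "finite A"
    and "\<And>x s. x \<in> A \<Longrightarrow> I s \<Longrightarrow> \<exists>r. body x s r \<and> (\<forall>s'. r = Continue s' \<longrightarrow> I s')"
    and "I s"
  shows "\<exists>r. for_each A body s r \<and> (\<forall>s'. r = Continue s' \<longrightarrow> I s')"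
proof -
  obtain xs where xs: "distinct xs" "set xs = A"
    using finite_distinct_list[OF assms(1)] by blast
  obtain r where "iterate body xs s r" "\<forall>s'. r = Continue s' \<longrightarrow> I s'"
    using iterate_total[of xs I body s, OF _ assms(3)] assms(2) unfolding xs(2) by metis
  with xs show ?thesis unfolding for_each_def by metis
qed

lemma dfs_total:
  fixes s :: "('v, 'e, 'm) state"
  assumes "fin_digraph G"
  shows "v \<in> verts G \<Longrightarrow> v \<notin> visited s \<Longrightarrow> remaining s \<subseteq> arcs G \<Longrightarrow>
    \<exists>r. dfs G M l v s r \<and>
      (\<forall>s'. r = Continue s' \<longrightarrow> visited s \<subseteq> visited s' \<and> remaining s' = remaining s)"
proof (induction "card (verts G - visited s)" arbitrary: v s rule: less_induct)
  case less
  interpret fin_digraph G by fact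
  define s0 where "s0 = s\<lparr>visited := insert v (visited s)\<rparr>"
  define I :: "('v, 'e, 'm) state \<Rightarrow> bool" where
    "I = (\<lambda>t. insert v (visited s) \<subseteq> visited t \<and> remaining t = remaining s)"
  define body :: "'e \<Rightarrow> ('v, 'e, 'm) state command" where
    "body = (\<lambda>e s r. if head G e \<notin> visited s
          then dfs G M l (head G e) (proceed_new_vertex M l v e (head G e) s) r
          else r = proceed_old_vertex M l v e (head G e) s)"
  have fin: "finite (outgoing G s v)"
    using less.prems(3) by (auto simp: outgoing_def intro: finite_subset[OF _ finite_arcs])
  have "\<exists>r. body e t r \<and> (\<forall>s'. r = Continue s' \<longrightarrow> I s')" if e: "e \<in> outgoing G s v" and t: "I t" for e t
  proof (cases "head G e \<in> visited t")
    case True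
    then show ?thesis
      using t by (auto simp: body_def I_def proceed_old_vertex_def Let_def)
  next
    case False
    let ?t = "proceed_new_vertex M l v e (head G e) t"
    have eq: "visited ?t = visited t" "remaining ?t = remaining t"
      by (simp_all add: proceed_new_vertex_def)
    have "verts G - visited ?t \<subset> verts G - visited s"
      using t less.prems by (auto simp: eq I_def)
    then have 1: "card (verts G - visited ?t) < card (verts G - visited s)"
      by (intro psubset_card_mono) auto
    have 2: "head G e \<in> verts G"
      using e less.prems(3) by (auto simp: outgoing_def)
    have 3: "head G e \<notin> visited ?t" using False by (simp add: eq)
    have 4: "remaining ?t \<subseteq> arcs G" using t less.prems(3) by (simp add: eq I_def)
    have "\<exists>r. dfs G M l (head G e) ?t r \<and>
        (\<forall>s'. r = Continue s' \<longrightarrow> visited ?t \<subseteq> visited s' \<and> remaining s' = remaining ?t)"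
      using 1 2 3 4 by (rule less.hyps)
    then obtain r where r: "dfs G M l (head G e) ?t r"
      "\<forall>s'. r = Continue s' \<longrightarrow> visited ?t \<subseteq> visited s' \<and> remaining s' = remaining ?t"
      by metis
    have "body e t r" using False r(1) by (simp add: body_def)
    moreover have "\<forall>s'. r = Continue s' \<longrightarrow> I s'"
      using t r(2) unfolding I_def eq by (metis subset_trans)
    ultimately show ?thesis by metis
  qed
  note step = this
  have "I s0" by (auto simp: I_def s0_def)
  have "\<exists>r. for_each (outgoing G s v) body s0 r \<and> (\<forall>s'. r = Continue s' \<longrightarrow> I s')"
    using fin step \<open>I s0\<close> by (rule for_each_total)
  then obtain r where r: "for_each (outgoing G s v) body s0 r" "\<forall>s'. r = Continue s' \<longrightarrow> I s'"
    by (elim exE conjE)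
  have "dfs G M l v s r"
    using r(1) unfolding body_def s0_def by (rule dfs.dfs)
  moreover have "\<forall>s'. r = Continue s' \<longrightarrow> visited s \<subseteq> visited s' \<and> remaining s' = remaining s"
    using r(2) unfolding I_def insert_subset by blast
  ultimately show ?case by metis
qed

lemma (in diagram) core_algorithm_total: "\<exists>b k. core_algorithm G M l b k"
proof -
  define I :: "('v, 'e, 'm) state \<Rightarrow> bool" where "I = (\<lambda>s. remaining s \<subseteq> arcs G)"
  have fin: "finite (outgoing G s v)" if "I s" for s :: "('v, 'e, 'm) state" and v
    using that by (auto simp: I_def outgoing_def intro: finite_subset[OF _ finite_arcs])
  have 1: "\<exists>r. remove_loops G M l s r \<and> (\<forall>s'. r = Continue s' \<longrightarrow> I s')" if "I s" for s
    unfolding remove_loops_def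
    by (intro for_each_total[where I = I] fin that finite_verts) (auto simp: I_def)
  have 2: "\<exists>r. remove_multiple_edges G l s r \<and> (\<forall>s'. r = Continue s' \<longrightarrow> I s')" if "I s" for s
    unfolding remove_multiple_edges_def
    by (intro for_each_total[where I = I] fin that finite_verts)
      (auto simp: I_def split: option.splits)
  have 3: "\<exists>r. search_all G M l s r \<and> (\<forall>s'. r = Continue s' \<longrightarrow> I s')" if "I s" for s
    unfolding search_all_def
  proof (intro for_each_total[where I = I] that finite_verts)
    fix v and s :: "('v, 'e, 'm) state"
    assume "v \<in> verts G" "I s"
    then show "\<exists>r. dfs G M l v (s\<lparr>visited := {}, mval := \<lambda>_. \<one>\<^bsub>M\<^esub>\<rparr>) r \<and>
        (\<forall>s'. r = Continue s' \<longrightarrow> I s')"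
      using dfs_total[OF fin_digraph, of v "s\<lparr>visited := {}, mval := \<lambda>_. \<one>\<^bsub>M\<^esub>\<rparr>" M l]
      by (auto simp: I_def)
  qed
  have seq: "\<exists>b t. (c andthen d) s (Exit b t)"
    if c: "\<exists>r. c s r \<and> (\<forall>s'. r = Continue s' \<longrightarrow> I s')" and d: "\<And>s. I s \<Longrightarrow> \<exists>b t. d s (Exit b t)"
    for c d s
  proof -
    obtain r where r: "c s r" "\<forall>s'. r = Continue s' \<longrightarrow> I s'" using c by blast
    show ?thesis
    proof (cases r)
      case (Continue s')
      with r d[of s'] show ?thesis unfolding seq_def by blast
    next
      case (Exit b s')
      with r show ?thesis unfolding seq_def by blast
    qed
  qed
  have "I (initial_state G M)" by (simp add: I_def initial_state_def)
  have "\<exists>b t. (remove_loops G M l andthen remove_multiple_edges G l andthen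
      search_all G M l andthen (\<lambda>s r. r = Exit True s)) (initial_state G M) (Exit b t)"
    using \<open>I (initial_state G M)\<close> by (intro seq[OF 1] seq[OF 2] seq[OF 3]) auto
  then show ?thesis unfolding core_algorithm_def by blast
qed

lemma ex_reduced_edges: "\<exists>E'. reduced_edges G E'"
proof -
  define A where "A = {e \<in> arcs G. head G e \<noteq> tail G e}"
  define f where "f = (\<lambda>e. (tail G e, head G e))"
  have "inv_into A f ` f ` A \<subseteq> A" by (auto intro: inv_into_into)
  moreover have "\<exists>!e'. e' \<in> inv_into A f ` f ` A \<and> f e' = f e" if "e \<in> A" for e
  proof (rule ex1I)
    show "inv_into A f (f e) \<in> inv_into A f ` f ` A \<and> f (inv_into A f (f e)) = f e"
      using that by (simp add: f_inv_into_f)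
  next
    fix e' assume e': "e' \<in> inv_into A f ` f ` A \<and> f e' = f e"
    then obtain y where "y \<in> f ` A" "e' = inv_into A f y" by blast
    with e' show "e' = inv_into A f (f e)" by (metis f_inv_into_f)
  qed
  ultimately have "reduced_edges G (inv_into A f ` f ` A)"
    unfolding reduced_edges_def A_def f_def by simp
  then show ?thesis ..
qed

end

theory Submission
  imports Defs
begin

text \<open>
  Multiplications happen only in the searches, so the bound has two ingredients.

  First, let \<open>R\<close> be the set of edges that survive the two removal phases. No edge in \<open>R\<close> is a loop and
  no two edges in \<open>R\<close> are parallel (\<open>remove_loops_outcome\<close>, \<open>remove_multiple_edges_outcome\<close>). Hence
  an edge in \<open>R\<close> is determined by its end points, which are also the end points of an edge in \<open>E'\<close>,
  so that \<open>card R \<le> card E'\<close>, although the algorithm may keep other representatives than \<open>E'\<close>.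

  Second, a single depth-first search inspects every edge at most once and multiplies once per
  inspection. The amortised form of this (\<open>dfs_potential\<close>) is that the number of multiplications
  done so far plus the number of edges with unvisited origin never increases during a search: visiting
  a vertex releases exactly its outgoing edges, and these pay for the loop over them. So a search
  costs at most \<open>card R\<close>. It costs nothing if its start vertex has no outgoing edge, and at most
  \<open>min (card V) (card R)\<close> vertices are origins of an edge in \<open>R\<close>. All searches together thus perform
  at most \<open>card R * min (card V) (card R)\<close> multiplications (\<open>search_all_cost\<close>), which implies the
  first inequality.

  The second inequality holds factor by factor: \<open>E'\<close> is a set of edges, and since these edges are
  determined by their end points, there are at most \<open>(card V)\<^sup>2\<close> of them.
\<close>

section \<open>Loops\<close>

text \<open>
  The proof rule for loops: the invariant is indexed by the set of elements still to be processed,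
  which makes it independent of the order of traversal. The two postconditions differ because a
  run that exits need not have restored the invariant.
\<close>

lemma for_each_rule:
  assumes "for_each A body s r" and "I A s"
    and body: "\<And>B x t r. B \<subseteq> A \<Longrightarrow> x \<in> B \<Longrightarrow> I B t \<Longrightarrow> body x t r \<Longrightarrow>
      case r of Continue t' \<Rightarrow> I (B - {x}) t' | Exit b t' \<Rightarrow> Q t'"
  shows "case r of Continue t \<Rightarrow> I {} t | Exit b t \<Rightarrow> Q t"
proof -
  obtain xs where xs: "distinct xs" "set xs = A" "iterate body xs s r"
    using assms(1) unfolding for_each_def by blast
  have "case r of Continue t \<Rightarrow> I {} t | Exit b t \<Rightarrow> Q t"
    if "iterate body ys s r" "distinct ys" "set ys \<subseteq> A" "I (set ys) s" for ys s r
    using that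
  proof induction
    case (empty s)
    then show ?case by simp
  next
    case (step x s s' ys r)
    have "set (x # ys) - {x} = set ys" using step.prems by auto
    then have "I (set ys) s'"
      using body[OF _ _ step.prems(3) step.hyps(1)] step.prems by simp
    then show ?case using step by simp
  next
    case (exit x s b s' ys)
    then show ?case using body[OF _ _ exit.prems(3) exit.hyps] by simp
  qed
  then show ?thesis using xs assms(2) by blast
qed

section \<open>Removing loops and multiple edges\<close>

lemma remove_loops_outcome:
  fixes s :: "('v, 'e, 'm) state"
  assumes run: "remove_loops G M l s r" and tails: "\<And>e. e \<in> remaining s \<Longrightarrow> tail G e \<in> verts G"
  shows "case r of
      Continue t \<Rightarrow> remaining t \<subseteq> {e \<in> remaining s. head G e \<noteq> tail G e} \<and> mults t = mults s
    | Exit b t \<Rightarrow> mults t = mults s"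
proof -
  define I where "I = (\<lambda>B (t :: ('v, 'e, 'm) state). remaining t \<subseteq> remaining s \<and> mults t = mults s \<and>
    (\<forall>e \<in> remaining t. head G e = tail G e \<longrightarrow> tail G e \<in> B))"
  have "case r of Continue t \<Rightarrow> I {} t | Exit b t \<Rightarrow> mults t = mults s"
    using run unfolding remove_loops_def
  proof (rule for_each_rule)
    show "I (verts G) s" using tails by (auto simp: I_def)
  next
    fix B v t r
    assume v: "v \<in> B" and t: "I B t"
      and inner: "for_each (outgoing G t v) (\<lambda>e s r. r =
       (if head G e = v then
          if l e \<noteq> \<one>\<^bsub>M\<^esub> then Exit False s
          else Continue (s\<lparr>remaining := remaining s - {e}\<rparr>)
        else Continue s)) t r"
    define J where "J = (\<lambda>D (u :: ('v, 'e, 'm) state). remaining u \<subseteq> remaining s \<and> mults u = mults s \<and>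
      (\<forall>e \<in> remaining u. head G e = tail G e \<longrightarrow> tail G e \<in> B - {v} \<or> e \<in> D))"
    have "case r of Continue u \<Rightarrow> J {} u | Exit b u \<Rightarrow> mults u = mults s"
      using inner
    proof (rule for_each_rule)
      show "J (outgoing G t v) t" using t by (auto simp: J_def I_def outgoing_def)
    next
      fix D e u r
      assume "D \<subseteq> outgoing G t v" "e \<in> D" "J D u"
        and "r = (if head G e = v then
          if l e \<noteq> \<one>\<^bsub>M\<^esub> then Exit False u
          else Continue (u\<lparr>remaining := remaining u - {e}\<rparr>)
        else Continue u)"
      moreover from this have "tail G e = v" by (auto simp: outgoing_def)
      ultimately show "case r of Continue u' \<Rightarrow> J (D - {e}) u' | Exit b u' \<Rightarrow> mults u' = mults s"
        by (auto simp: J_def)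
    qed
    then show "case r of Continue t' \<Rightarrow> I (B - {v}) t' | Exit b t' \<Rightarrow> mults t' = mults s"
      by (auto simp: I_def J_def split: outcome.splits)
  qed
  then show ?thesis by (auto simp: I_def split: outcome.splits)
qed

lemma remove_multiple_edges_outcome:
  fixes s :: "('v, 'e, 'm) state"
  assumes run: "remove_multiple_edges G l s r"
    and tails: "\<And>e. e \<in> remaining s \<Longrightarrow> tail G e \<in> verts G"
  shows "case r of
      Continue t \<Rightarrow> remaining t \<subseteq> remaining s \<and> mults t = mults s \<and>
        inj_on (\<lambda>e. (tail G e, head G e)) (remaining t)
    | Exit b t \<Rightarrow> mults t = mults s"
proof -
  define parallel where "parallel = (\<lambda>e e'. e \<noteq> e' \<and> tail G e = tail G e' \<and> head G e = head G e')"
  define I where "I = (\<lambda>B (t :: ('v, 'e, 'm) state). remaining t \<subseteq> remaining s \<and> mults t = mults s \<and>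
    (\<forall>e \<in> remaining t. \<forall>e' \<in> remaining t. parallel e e' \<longrightarrow> tail G e \<in> B))"
  have "case r of Continue t \<Rightarrow> I {} t | Exit b t \<Rightarrow> mults t = mults s"
    using run unfolding remove_multiple_edges_def
  proof (rule for_each_rule)
    show "I (verts G) s" using tails by (auto simp: I_def)
  next
    fix B v t r
    assume v: "v \<in> B" and t: "I B t"
      and inner: "for_each (outgoing G t v) (\<lambda>e s r. r =
       (case tab s (head G e) of
          None \<Rightarrow> Continue (s\<lparr>tab := (tab s)(head G e := Some (l e))\<rparr>)
        | Some a \<Rightarrow>
            if l e \<noteq> a then Exit False s
            else Continue (s\<lparr>remaining := remaining s - {e}\<rparr>))) (t\<lparr>tab := \<lambda>_. None\<rparr>) r"
    define J where "J = (\<lambda>D (u :: ('v, 'e, 'm) state). remaining u \<subseteq> remaining s \<and> mults u = mults s \<and>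
      (\<forall>e \<in> remaining u. \<forall>e' \<in> remaining u. parallel e e' \<longrightarrow>
        tail G e \<in> B - {v} \<or> e \<in> D \<or> e' \<in> D) \<and>
      (\<forall>e \<in> remaining u. tail G e = v \<longrightarrow> e \<in> D \<or> tab u (head G e) \<noteq> None))"
    have "case r of Continue u \<Rightarrow> J {} u | Exit b u \<Rightarrow> mults u = mults s"
      using inner
    proof (rule for_each_rule)
      show "J (outgoing G t v) (t\<lparr>tab := \<lambda>_. None\<rparr>)"
        using t by (auto simp: J_def I_def outgoing_def)
    next
      fix D e u r
      assume "D \<subseteq> outgoing G t v" "e \<in> D" and J: "J D u"
        and r: "r = (case tab u (head G e) of
          None \<Rightarrow> Continue (u\<lparr>tab := (tab u)(head G e := Some (l e))\<rparr>)
        | Some a \<Rightarrow>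
            if l e \<noteq> a then Exit False u
            else Continue (u\<lparr>remaining := remaining u - {e}\<rparr>))"
      then have e: "tail G e = v" by (auto simp: outgoing_def)
      show "case r of Continue u' \<Rightarrow> J (D - {e}) u' | Exit b u' \<Rightarrow> mults u' = mults s"
      proof (cases "tab u (head G e)")
        case None
        \<comment> \<open>Keeping \<open>e\<close> is harmless: a kept edge parallel to it would have filled its table entry.\<close>
        have "e' \<in> D" if "e' \<in> remaining u" "parallel e e' \<or> parallel e' e" for e'
          using that J None e unfolding J_def parallel_def by metis
        moreover have "J (D - {e}) (u\<lparr>tab := (tab u)(head G e := Some (l e))\<rparr>)"
          using J calculation unfolding J_def parallel_def by auto
        ultimately show ?thesis using None r by simp
      next
        case (Some a)
        then show ?thesis using J r unfolding J_def by auto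
      qed
    qed
    then show "case r of Continue t' \<Rightarrow> I (B - {v}) t' | Exit b t' \<Rightarrow> mults t' = mults s"
      by (auto simp: I_def J_def split: outcome.splits)
  qed
  then show ?thesis
    by (auto simp: I_def parallel_def inj_on_def split: outcome.splits)
qed

section \<open>The cost of the searches\<close>

text \<open>
  The potential of the amortised analysis: an edge with unvisited origin carries a credit for the
  multiplication that its inspection will cost.
\<close>

definition potential :: "('v, 'e) pre_digraph \<Rightarrow> ('v, 'e, 'm) state \<Rightarrow> nat" where
  "potential G s = mults s + card {e \<in> remaining s. tail G e \<notin> visited s}"

lemma potential_visit:
  assumes "finite (remaining s)" and "v \<notin> visited s"
  shows "potential G (s\<lparr>visited := insert v (visited s)\<rparr>) + card (outgoing G s v) = potential G s"
proof -
  have "{e \<in> remaining s. tail G e \<notin> visited s} =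
      {e \<in> remaining s. tail G e \<notin> insert v (visited s)} \<union> outgoing G s v"
    using assms(2) by (auto simp: outgoing_def)
  moreover have "card (\<dots>) = card {e \<in> remaining s. tail G e \<notin> insert v (visited s)} +
      card (outgoing G s v)"
    using assms(1) by (intro card_Un_disjoint) (auto simp: outgoing_def)
  ultimately show ?thesis by (simp add: potential_def)
qed

text \<open>
  The loop over the outgoing edges of \<open>v\<close> starts with the credits released by visiting \<open>v\<close>. Each
  pass spends the credit of its edge on its own multiplication, and by induction a recursive call
  pays for itself.
\<close>

lemma dfs_potential:
  fixes G :: "('v, 'e) pre_digraph" and s :: "('v, 'e, 'm) state"
  assumes "dfs G M l v s r" and "v \<notin> visited s" and "finite (remaining s)"
  shows "case r of
      Continue t \<Rightarrow> remaining t = remaining s \<and> potential G t \<le> potential G s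
    | Exit b t \<Rightarrow> potential G t \<le> potential G s"
  using assms
proof (induction rule: dfs.induct)
  case (dfs s v r)
  define I where "I = (\<lambda>(D :: 'e set) (t :: ('v, 'e, 'm) state). remaining t = remaining s \<and>
    potential G t + card D \<le> potential G s)"
  have fin: "finite (outgoing G s v)" using dfs.prems by (simp add: outgoing_def)
  have "case r of Continue t \<Rightarrow> I {} t | Exit b t \<Rightarrow> potential G t \<le> potential G s"
    using dfs.IH
  proof (rule for_each_rule)
    show "I (outgoing G s v) (s\<lparr>visited := insert v (visited s)\<rparr>)"
      using potential_visit[OF dfs.prems(2,1)] by (simp add: I_def)
  next
    fix D e t r
    assume D: "D \<subseteq> outgoing G s v" "e \<in> D" and t: "I D t"
      and body: "if head G e \<notin> visited t
        then dfs G M l (head G e) (proceed_new_vertex M l v e (head G e) t) r \<and>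
          (head G e \<notin> visited (proceed_new_vertex M l v e (head G e) t) \<longrightarrow>
           finite (remaining (proceed_new_vertex M l v e (head G e) t)) \<longrightarrow>
           (case r of
              Continue t' \<Rightarrow> remaining t' = remaining (proceed_new_vertex M l v e (head G e) t) \<and>
                potential G t' \<le> potential G (proceed_new_vertex M l v e (head G e) t)
            | Exit b t' \<Rightarrow> potential G t' \<le> potential G (proceed_new_vertex M l v e (head G e) t)))
        else r = proceed_old_vertex M l v e (head G e) t"
    have D_card: "card D = card (D - {e}) + 1"
      using D fin by (metis Suc_eq_plus1 card_Suc_Diff1 finite_subset)
    have rem: "remaining t = remaining s" and pot: "potential G t + card D \<le> potential G s"
      using t by (simp_all add: I_def)
    show "case r of Continue t' \<Rightarrow> I (D - {e}) t' | Exit b t' \<Rightarrow> potential G t' \<le> potential G s"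
    proof (cases "head G e \<in> visited t")
      case True
      then show ?thesis
        using rem pot body D_card
        by (simp add: I_def proceed_old_vertex_def potential_def Let_def)
    next
      case False
      let ?t = "proceed_new_vertex M l v e (head G e) t"
      have "potential G ?t + card (D - {e}) \<le> potential G s"
        using pot D_card by (simp add: proceed_new_vertex_def potential_def)
      moreover have "remaining ?t = remaining s" "visited ?t = visited t"
        using rem by (simp_all add: proceed_new_vertex_def)
      ultimately show ?thesis
        using False body dfs.prems by (auto simp: I_def split: outcome.splits)
    qed
  qed
  then show ?case by (auto simp: I_def split: outcome.splits)
qed

lemma dfs_without_outgoing:
  assumes "dfs G M l v s r" and "outgoing G s v = {}"
  shows "r = Continue (s\<lparr>visited := insert v (visited s)\<rparr>)"
  using assms(1)
proof cases
  case dfs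
  then have "iterate (\<lambda>e s r.
          if head G e \<notin> visited s
          then dfs G M l (head G e) (proceed_new_vertex M l v e (head G e) s) r
          else r = proceed_old_vertex M l v e (head G e) s) []
      (s\<lparr>visited := insert v (visited s)\<rparr>) r"
    using assms(2) by (simp add: for_each_def)
  then show ?thesis by cases
qed

text \<open>
  Every pending start vertex is charged \<open>card (remaining s)\<close> in advance, but only if it is the origin of
  a remaining edge: from any other vertex the search stops at once. This restriction is what makes
  the bound depend on the number of edges when the graph has many isolated vertices.
\<close>

lemma search_all_cost:
  fixes s :: "('v, 'e, 'm) state"
  assumes run: "search_all G M l s r" and fin: "finite (remaining s)" "finite (verts G)"
    and tails: "\<And>e. e \<in> remaining s \<Longrightarrow> tail G e \<in> verts G"
  defines "cost \<equiv> card (remaining s) * card (tail G ` remaining s)"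
  shows "case r of Continue t \<Rightarrow> mults t \<le> mults s + cost | Exit b t \<Rightarrow> mults t \<le> mults s + cost"
proof -
  define I where "I = (\<lambda>B (t :: ('v, 'e, 'm) state). remaining t = remaining s \<and>
    mults t + card (remaining s) * card (B \<inter> tail G ` remaining s) \<le> mults s + cost)"
  have "case r of Continue t \<Rightarrow> I {} t | Exit b t \<Rightarrow> mults t \<le> mults s + cost"
    using run unfolding search_all_def
  proof (rule for_each_rule)
    have "verts G \<inter> tail G ` remaining s = tail G ` remaining s" using tails by auto
    then show "I (verts G) s" by (simp add: I_def cost_def)
  next
    fix B v t r
    assume B: "B \<subseteq> verts G" "v \<in> B" and t: "I B t"
      and dfs: "dfs G M l v (t\<lparr>visited := {}, mval := \<lambda>_. \<one>\<^bsub>M\<^esub>\<rparr>) r"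
    let ?t = "t\<lparr>visited := {}, mval := \<lambda>_. \<one>\<^bsub>M\<^esub>\<rparr>"
    show "case r of Continue t' \<Rightarrow> I (B - {v}) t' | Exit b t' \<Rightarrow> mults t' \<le> mults s + cost"
    proof (cases "v \<in> tail G ` remaining s")
      case True
      have "finite B" using B fin finite_subset by blast
      then have "card (B \<inter> tail G ` remaining s) = Suc (card (B \<inter> tail G ` remaining s - {v}))"
        using B True card_Suc_Diff1[of "B \<inter> tail G ` remaining s" v] by simp
      moreover have "(B - {v}) \<inter> tail G ` remaining s = B \<inter> tail G ` remaining s - {v}" by blast
      ultimately have "potential G ?t + card (remaining s) * card ((B - {v}) \<inter> tail G ` remaining s)
          \<le> mults s + cost"
        using t by (simp add: I_def potential_def)
      then show ?thesis
        using dfs_potential[OF dfs] t fin unfolding I_def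
        by (cases r) (fastforce simp: potential_def)+
    next
      case False
      then have "outgoing G ?t v = {}" using t by (auto simp: I_def outgoing_def)
      moreover have "(B - {v}) \<inter> tail G ` remaining s = B \<inter> tail G ` remaining s"
        using False by auto
      ultimately show ?thesis using dfs_without_outgoing[OF dfs] t by (simp add: I_def)
    qed
  qed
  then show ?thesis by (auto simp: I_def split: outcome.splits)
qed

section \<open>The bound\<close>

lemma reduced_edges_inj_on:
  assumes "reduced_edges G E'"
  shows "inj_on (\<lambda>e. (tail G e, head G e)) E'"
proof (rule inj_onI)
  fix e e'
  assume e: "e \<in> E'" "e' \<in> E'" and "(tail G e, head G e) = (tail G e', head G e')"
  then have ends: "tail G e' = tail G e" "head G e' = head G e" by simp_all
  have "\<exists>!e'. e' \<in> E' \<and> tail G e' = tail G e \<and> head G e' = head G e"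
    using assms e(1) unfolding reduced_edges_def by blast
  then show "e = e'" using e ends by blast
qed

text \<open>
  Edge sets are compared through the pairs of their end points, since \<open>R\<close> and \<open>E'\<close> may contain
  different representatives of a class of parallel edges.
\<close>

lemma card_le_reduced_edges:
  assumes "reduced_edges G E'" and "finite (arcs G)"
    and "R \<subseteq> {e \<in> arcs G. head G e \<noteq> tail G e}" and "inj_on (\<lambda>e. (tail G e, head G e)) R"
  shows "card R \<le> card E'"
proof -
  let ?ends = "\<lambda>e. (tail G e, head G e)"
  have "finite E'" using assms by (auto simp: reduced_edges_def intro: finite_subset)
  moreover have "?ends ` R \<subseteq> ?ends ` E'"
  proof (rule image_subsetI)
    fix e assume "e \<in> R"
    then obtain e' where e': "e' \<in> E'" "tail G e' = tail G e" "head G e' = head G e"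
      using assms(1,3) unfolding reduced_edges_def by blast
    then have "?ends e = ?ends e'" by simp
    then show "?ends e \<in> ?ends ` E'" using e'(1) by (rule image_eqI)
  qed
  ultimately show ?thesis using assms(4) by (metis card_image card_image_le card_mono finite_imageI
        le_trans)
qed

lemma (in diagram) core_algorithm_cost:
  assumes run: "core_algorithm G M l b k" and E': "reduced_edges G E'"
  shows "k \<le> card E' * min (card (verts G)) (card E')"
proof -
  obtain s where s: "(remove_loops G M l andthen remove_multiple_edges G l andthen
      search_all G M l andthen (\<lambda>s r. r = Exit True s)) (initial_state G M) (Exit b s)"
    and k: "k = mults s"
    using run unfolding core_algorithm_def by blast
  let ?s0 = "initial_state G M"
  have tails0: "tail G e \<in> verts G" if "e \<in> remaining ?s0" for e
    using that by (simp add: initial_state_def)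
  note loops = remove_loops_outcome[OF _ tails0]
  \<comment> \<open>The run either exits during the removal phases, before any multiplication, or reaches the
    searches with a graph without loops and parallel edges.\<close>
  consider (early) "mults s = 0"
    | (search) s2 r where "remaining s2 \<subseteq> {e \<in> arcs G. head G e \<noteq> tail G e}" "mults s2 = 0"
        "inj_on (\<lambda>e. (tail G e, head G e)) (remaining s2)"
        "search_all G M l s2 r" "r = Continue s \<or> r = Exit b s"
  proof (cases "remove_loops G M l ?s0 (Exit b s)")
    case True
    then show ?thesis using loops early by (force simp: initial_state_def)
  next
    case False
    then obtain s1 where s1: "remove_loops G M l ?s0 (Continue s1)"
      and rest: "(remove_multiple_edges G l andthen search_all G M l andthen
        (\<lambda>s r. r = Exit True s)) s1 (Exit b s)"
      using s unfolding seq_def[of "remove_loops G M l"] by auto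
    have s1': "remaining s1 \<subseteq> {e \<in> arcs G. head G e \<noteq> tail G e}" "mults s1 = 0"
      using loops[OF s1] by (auto simp: initial_state_def)
    have tails1: "tail G e \<in> verts G" if "e \<in> remaining s1" for e
      using that s1' by auto
    note multiple = remove_multiple_edges_outcome[OF _ tails1]
    show ?thesis
    proof (cases "remove_multiple_edges G l s1 (Exit b s)")
      case True
      then show ?thesis using multiple s1' early by force
    next
      case False
      then obtain s2 where s2: "remove_multiple_edges G l s1 (Continue s2)"
        and "(search_all G M l andthen (\<lambda>s r. r = Exit True s)) s2 (Exit b s)"
        using rest unfolding seq_def[of "remove_multiple_edges G l"] by auto
      then obtain r where "search_all G M l s2 r" "r = Continue s \<or> r = Exit b s"
        unfolding seq_def by auto
      then show ?thesis using multiple[OF s2] s1' by (intro search[of s2 r]) auto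
    qed
  qed
  then show ?thesis
  proof cases
    case early
    then show ?thesis using k by simp
  next
    case search
    let ?R = "remaining s2"
    have fin: "finite ?R"
      using search(1) by (auto intro: finite_subset)
    have tails: "tail G e \<in> verts G" if "e \<in> ?R" for e using that search(1) by auto
    have "mults s \<le> card ?R * card (tail G ` ?R)"
      using search_all_cost[OF search(4) fin finite_verts tails] search(2,5) by auto
    moreover have "card (tail G ` ?R) \<le> min (card (verts G)) (card ?R)"
      using fin tails by (auto intro: card_image_le card_mono)
    moreover have "card ?R \<le> card E'"
      using E' finite_arcs search(1,3) by (rule card_le_reduced_edges)
    ultimately have "mults s \<le> card E' * min (card (verts G)) (card E')"
      by (meson le_trans min.mono mult_le_mono order_refl)
    then show ?thesis using k by simp
  qed
qed

lemma (in fin_digraph) card_reduced_edges_le: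
  assumes "reduced_edges G E'"
  shows "card E' \<le> min ((card (verts G))\<^sup>2) (card (arcs G))"
proof -
  have E': "E' \<subseteq> arcs G" using assms by (auto simp: reduced_edges_def)
  then have "(\<lambda>e. (tail G e, head G e)) ` E' \<subseteq> verts G \<times> verts G" by auto
  then have "card E' \<le> card (verts G \<times> verts G)"
    using reduced_edges_inj_on[OF assms] by (intro card_inj_on_le) auto
  moreover have "card E' \<le> card (arcs G)" using E' by (intro card_mono) auto
  ultimately show ?thesis by (simp add: card_cartesian_product power2_eq_square)
qed

theorem theorem7p2:
  fixes G :: "('v, 'e) pre_digraph" and M :: "('m, 'x) monoid_scheme" and l :: "'e \<Rightarrow> 'm"
  assumes "diagram G M l" and "reduced_edges G E'"
  shows "(\<forall>b k. core_algorithm G M l b k \<longrightarrow>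
            k \<le> card E' * min (card (verts G)) (card E' + 1)) \<and>
         card E' * min (card (verts G)) (card E' + 1)
           \<le> min ((card (verts G))^2) (card (arcs G)) * min (card (verts G)) (card (arcs G) + 1)"
proof (intro conjI allI impI)
  interpret diagram G M l by fact
  fix b k
  assume "core_algorithm G M l b k"
  then have "k \<le> card E' * min (card (verts G)) (card E')"
    using assms(2) by (rule core_algorithm_cost)
  also have "\<dots> \<le> card E' * min (card (verts G)) (card E' + 1)"
    by (intro mult_le_mono2) simp
  finally show "k \<le> card E' * min (card (verts G)) (card E' + 1)" .
next
  interpret diagram G M l by fact
  have "card E' \<le> min ((card (verts G))\<^sup>2) (card (arcs G))"
    using assms(2) by (rule card_reduced_edges_le)
  then show "card E' * min (card (verts G)) (card E' + 1)
      \<le> min ((card (verts G))^2) (card (arcs G)) * min (card (verts G)) (card (arcs G) + 1)"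
    by (intro mult_le_mono min.mono) auto
qed

end
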